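(* Let $q$ be a prime power, $s\ge 2$ an integer, and $a\ge 0$ an integer with $s>a$ such that $\frac{s+a}{2}$ is an odd integer and $n_1=(q^s-1)(q^a+1)$ divides $q^{2s}-1$. Let $0=a'_0<a'_1<\dots<a'_{\nu'}$ be the minimum representatives of the cyclotomic cosets modulo $n_1$ with respect to $q^2$, and let $1\le\tau'\le\nu'$. Then the BCH code $\mathrm{BCH}^{n_1}(1,\tau')$ over $\mathbb{F}_{q^2}$ is Hermitian self-orthogonal if and only if $$a'_{\tau'}\le q^{\frac{s+a}{2}}+q^{\frac{s-a}{2}}-2\quad\text{when } a\ne 0,$$ respectively, if and only if $$a'_{\tau'}\le 2q^{\frac{s}{2}}-3\quad\text{when } a=0.$$
   Context: Let $n_1\mid q^{2s}-1$ and $E(n_1)=\{0,1,\dots,n_1-1\}$, regarded as a set of representatives of $\mathbb{Z}/n_1\mathbb{Z}$. The cyclotomic cosets in $E(n_1)$ with respect to $q^2$ are the sets $\{q^{2i}e\bmod n_1: i\ge 0\}$, $e\in E(n_1)$; $\Lambda'_b$ denotes the coset with minimum element $b$. Let $U(n_1)=\{\beta_1,\dots,\beta_{n_1}\}\subset\mathbb{F}_{q^{2s}}$ be the zeros of $X^{n_1}-1$, and for $\Delta\subseteq E(n_1)$ let $\mathcal{C}^{U(n_1)}_\Delta\subseteq\mathbb{F}_{q^{2s}}^{n_1}$ be the $\mathbb{F}_{q^{2s}}$-span of the vectors $(\beta_1^e,\dots,\beta_{n_1}^e)$, $e\in\Delta$. Then $\mathrm{BCH}^{n_1}(1,\tau')=\mathcal{C}^{U(n_1)}_{\Delta}\cap\mathbb{F}_{q^2}^{n_1}$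 with $\Delta=\Lambda'_{a'_1}\cup\dots\cup\Lambda'_{a'_{\tau'}}$. A linear code $\mathcal{C}\subseteq\mathbb{F}_{q^2}^{n_1}$ is Hermitian self-orthogonal if $\sum_i x_iy_i^q=0$ for all $\boldsymbol{x},\boldsymbol{y}\in\mathcal{C}$. *)

theory Defs
  imports
    "HOL-Analysis.Analysis"
    "HOL-Number_Theory.Prime_Powers"
    "HOL-Algebra.Algebraic_Closure_Type"
begin

text \<open>
  The elements of \<open>{..<n}\<close> stand for the residues modulo \<open>n\<close>; cosets are taken with
  respect to \<open>q\<^sup>2\<close>.
\<close>

definition cyclotomic_coset :: "nat \<Rightarrow> nat \<Rightarrow> nat \<Rightarrow> nat set" where
  "cyclotomic_coset q n e = {(q ^ (2 * i) * e) mod n | i. True}"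

definition cyclotomic_cosets :: "nat \<Rightarrow> nat \<Rightarrow> nat set set" where
  "cyclotomic_cosets q n = cyclotomic_coset q n ` {..<n}"

definition minimum_representatives :: "nat \<Rightarrow> nat \<Rightarrow> nat set" where
  "minimum_representatives q n = Min ` cyclotomic_cosets q n"

text \<open>
  In the next definitions \<open>\<beta>\<close> lists the evaluation points, so a word of length \<open>n\<close> is a vector
  over an index type \<open>'n\<close> with \<open>n\<close> elements. The span is over the whole field \<open>'a\<close>.
\<close>

definition evaluation_code :: "('n::finite \<Rightarrow> 'a::field) \<Rightarrow> nat set \<Rightarrow> ('a ^ 'n) set" where
  "evaluation_code \<beta> \<Delta> = vec.span ((\<lambda>e. \<chi> i. \<beta> i ^ e) ` \<Delta>)"

text \<open>
  \<open>K\<close> is the subfield of order \<open>q\<^sup>2\<close>. As \<open>b j\<close> enumerates the minimum representatives,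
  \<open>cyclotomic_coset q n (b j)\<close> is the coset whose minimum element is \<open>b j\<close>. The union starts
  at \<open>j = 1\<close>, so the coset of \<open>b 0 = 0\<close> is left out.
\<close>

definition BCH_code ::
  "nat \<Rightarrow> nat \<Rightarrow> 'a set \<Rightarrow> ('n::finite \<Rightarrow> 'a::field) \<Rightarrow> (nat \<Rightarrow> nat) \<Rightarrow> nat \<Rightarrow> ('a ^ 'n) set" where
  "BCH_code q n K \<beta> b \<tau> =
     evaluation_code \<beta> (\<Union>j\<in>{1..\<tau>}. cyclotomic_coset q n (b j)) \<inter> {v. \<forall>i. v $ i \<in> K}"

definition hermitian_self_orthogonal :: "nat \<Rightarrow> ('a::field ^ 'n::finite) set \<Rightarrow> bool" where
  "hermitian_self_orthogonal q C \<longleftrightarrow>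
     (\<forall>x\<in>C. \<forall>y\<in>C. (\<Sum>i\<in>UNIV. x $ i * (y $ i) ^ q) = 0)"

end

theory Submission
  imports Defs "HOL-Number_Theory.Residues"
begin

text \<open>
  Put \<open>m = (s + a) div 2\<close> and \<open>h = (s - a) div 2\<close>. Character sums over the \<open>n\<^sub>1\<close>-th roots of unity,
  together with nondegeneracy of the trace, show that the code is self-orthogonal exactly when
  no two exponents \<open>e\<close>, \<open>f\<close> of its defining set satisfy \<open>n\<^sub>1 dvd e + f * q\<close>. On coset
  representatives this reads \<open>n\<^sub>1 dvd u + v * q ^ t\<close> with \<open>t\<close> odd, and by symmetry \<open>t \<le> s\<close>.
  If \<open>u\<close> and \<open>v\<close> are at most the stated bound, then for \<open>t \<le> m\<close> the sum is smaller than \<open>n\<^sub>1\<close>,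
  while for \<open>t \<ge> m + 2\<close> its reduction modulo \<open>q ^ s - 1\<close> is positive and smaller than
  \<open>q ^ s - 1\<close>; parity excludes \<open>t = m \<plusminus> 1\<close>. The bound is sharp because, for \<open>w\<close> one above it,
  \<open>n\<^sub>1 - w * q ^ m\<close> lies between \<open>1\<close> and \<open>w\<close>.
\<close>

section \<open>Congruences between small exponents\<close>

text \<open>Rests on \<open>q ^ (m + h) * q ^ (m - h) = q ^ m * q ^ m\<close>. The negative terms
  stand on the left, so the conclusion is free of truncated subtraction.\<close>

lemma degree_bound_expand:
  fixes q m h n :: nat
  assumes "h \<le> m" "q \<ge> 2" "n = (q ^ (m + h) - 1) * (q ^ (m - h) + 1)"
  shows "n + q ^ (m - h) + 1 = q ^ m * q ^ m + q ^ (m + h)"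
proof -
  have e: "q ^ (m + h) * q ^ (m - h) = q ^ m * q ^ m"
    using assms(1) by (simp flip: power_add)
  obtain k where k: "q ^ (m + h) = Suc k"
    using assms(2) by (metis gr0_implies_Suc not_numeral_le_zero power_eq_0_iff zero_less_iff_neq_zero)
  show ?thesis
    unfolding assms(3) e[symmetric] unfolding k by (simp add: algebra_simps)
qed

text \<open>\<open>D\<close> bounds both exponents. For \<open>h = m\<close> (that is,
  \<open>a = 0\<close>) the range is one shorter, because
  \<open>(2 * q ^ m - 2) * (q ^ m + 1) = n\<close>.\<close>

lemma not_dvd_small_pair_aux:
  fixes q m h n D u v t :: nat
  assumes q: "q \<ge> 2" and h: "0 < h" "h \<le> m" and m: "odd m"
    and n: "n = (q ^ (m + h) - 1) * (q ^ (m - h) + 1)"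
    and D: "D + 2 \<le> q ^ m + q ^ h" "h = m \<Longrightarrow> D + 3 \<le> 2 * q ^ m"
    and u: "0 < u" "u \<le> D" and v: "0 < v" "v \<le> D"
    and t: "odd t" "t \<le> m + h"
  shows "\<not> n dvd u + v * q ^ t"
proof -
  note N = degree_bound_expand[OF h(2) q n]
  have pos [simp]: "q ^ i > 0" for i using q by simp
  have hm: "q ^ h \<le> q ^ m" using h q by (simp add: power_increasing)
  \<comment> \<open>This weaker form serves the two outer ranges of \<open>t\<close>; only
    \<open>t = m\<close> needs the sharp bounds.\<close>
  have D2: "D + 2 \<le> 2 * q ^ m" using D hm by linarith
  have four: "4 * q ^ i \<le> q ^ j" if "i + 2 \<le> j" for i j
  proof -
    have "4 * q ^ i \<le> q ^ 2 * q ^ i" using power_mono[OF q, of 2] by (intro mult_right_mono) auto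
    also have "\<dots> = q ^ (2 + i)" by (simp only: power_add)
    also have "\<dots> \<le> q ^ j" using that q by (intro power_increasing) auto
    finally show ?thesis .
  qed
  consider "t + 2 \<le> m" | "t = m" | "m + 2 \<le> t"
    using m t(1) by (metis Suc_leI add_2_eq_Suc' dvd_def even_Suc le_neq_implies_less linorder_not_le not_less_eq_eq)
  then show ?thesis
  proof cases
    case 1
    have "2 * (1 + q ^ t) \<le> 4 * q ^ t" using q by simp
    also have "\<dots> \<le> q ^ m" using four[OF 1] .
    finally have "2 * (1 + q ^ t) \<le> q ^ m" .
    then have le: "2 * q ^ m * (1 + q ^ t) \<le> q ^ m * q ^ m"
      using mult_le_mono2 by (metis mult.assoc mult.commute)
    have "u + v * q ^ t \<le> D + D * q ^ t" using u v by (intro add_mono mult_right_mono) auto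
    also have "\<dots> = D * (1 + q ^ t)" by (simp add: algebra_simps)
    also have "\<dots> < 2 * q ^ m * (1 + q ^ t)" using D2 by (intro mult_strict_right_mono) auto
    also have "\<dots> \<le> q ^ m * q ^ m" by (fact le)
    \<comment> \<open>As \<open>h > 0\<close>, the term \<open>q ^ (m + h)\<close> outweighs
      \<open>q ^ (m - h) + 1\<close>.\<close>
    also have "\<dots> \<le> n"
      using N four[of "m - h" "m + h"] h pos[of "m - h"] by linarith
    finally show ?thesis using u by (auto dest: dvd_imp_le)
  next
    case 2
    have "u + v * q ^ m \<le> D + D * q ^ m" using u v by (intro add_mono mult_right_mono) auto
    also have "\<dots> < n"
    proof (cases "h = m")
      case True
      have "(D + 3) * (q ^ m + 1) \<le> 2 * q ^ m * (q ^ m + 1)"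
        using D(2)[OF True] by (intro mult_right_mono) auto
      moreover have "n + 2 = 2 * (q ^ m * q ^ m)" using N True by (simp add: power_add)
      ultimately show ?thesis using pos[of m] by (simp add: algebra_simps)
    next
      case False
      have e: "q ^ h * q ^ (m - h) = q ^ m" using h(2) by (simp flip: power_add)
      have ge: "q ^ h \<ge> 2" "q ^ (m - h) \<ge> 2"
        using self_le_power[of q h] self_le_power[of q "m - h"] q h False by auto
      \<comment> \<open>With \<open>x = q ^ h\<close> and \<open>y = q ^ (m - h)\<close> this is
        \<open>x + y \<le> x * y\<close> for \<open>x, y \<ge> 2\<close>, exactly what remains of
        the estimate after expansion. It fails for \<open>y = 1\<close>, hence the split on
        \<open>h = m\<close>.\<close>
      have "q ^ h + q ^ (m - h) \<le> q ^ h * q ^ (m - h)"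
      proof -
        obtain x y where "q ^ h = x + 2" "q ^ (m - h) = y + 2" using ge
          by (metis add.commute le_Suc_ex)
        then show ?thesis by (simp add: algebra_simps)
      qed
      moreover have "(D + 2) * (q ^ m + 1) \<le> (q ^ m + q ^ h) * (q ^ m + 1)"
        using D(1) by (intro mult_right_mono) auto
      ultimately show ?thesis using N e by (simp add: algebra_simps power_add)
    qed
    finally show ?thesis using u 2 by (auto dest: dvd_imp_le)
  next
    case 3
    \<comment> \<open>Splitting off the low digits \<open>v0\<close> of \<open>v\<close> gives
      \<open>v * q ^ t = v1 * q ^ (m + h) + v0 * q ^ t\<close>; modulo
      \<open>q ^ (m + h) - 1\<close> the high digits \<open>v1\<close> wrap around to the
      bottom.\<close>
    define r v0 v1 where "r = q ^ (m + h - t)" and "v0 = v mod r" and "v1 = v div r"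
    have r: "r * q ^ t = q ^ (m + h)" "r > 0" using t(2) q by (auto simp: r_def simp flip: power_add)
    have v: "v = v1 * r + v0" "v0 < r" using r by (auto simp: v0_def v1_def)
    have "v1 \<le> D" using \<open>v \<le> D\<close> unfolding v1_def by (meson div_le_dividend order_trans)
    moreover have "4 * q ^ m \<le> q ^ t" using four[OF 3] .
    ultimately have small: "u + v1 + 1 < q ^ t" using u D2 by linarith
    have "(v0 + 1) * q ^ t \<le> r * q ^ t" using v by (intro mult_right_mono) auto
    then have W: "u + v1 + v0 * q ^ t < q ^ (m + h) - 1" using small r by (simp add: algebra_simps)
    have "u + v * q ^ t = u + v1 * q ^ (m + h) + v0 * q ^ t"
      unfolding r(1)[symmetric] using v by (simp add: algebra_simps)
    also have "\<dots> = (u + v1 + v0 * q ^ t) + v1 * (q ^ (m + h) - 1)"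
      using pos[of "m + h"] by (cases "q ^ (m + h)") (simp_all add: algebra_simps del: pos)
    finally have E: "u + v * q ^ t = (u + v1 + v0 * q ^ t) + v1 * (q ^ (m + h) - 1)" .
    show ?thesis
    proof
      assume "n dvd u + v * q ^ t"
      then have "q ^ (m + h) - 1 dvd u + v * q ^ t" unfolding n by (rule dvd_mult_left)
      then have "q ^ (m + h) - 1 dvd u + v1 + v0 * q ^ t" unfolding E by simp
      then show False using W u by (auto dest: dvd_imp_le)
    qed
  qed
qed

lemma cong_power_1:
  fixes n q s :: nat
  assumes "n dvd q ^ s - 1" "q > 0"
  shows "[q ^ (s * k) = 1] (mod n)"
proof -
  have "[q ^ s = 1] (mod n)"
    using assms by (metis One_nat_def Suc_leI cong_altdef_nat cong_sym zero_less_power)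
  from cong_pow[OF this, of k] show ?thesis by (simp add: power_mult)
qed

text \<open>Modulo \<open>n\<close>, \<open>t\<close> may be reduced modulo the even number
  \<open>2 * (m + h)\<close>, which keeps it odd. A remainder \<open>r\<close> above
  \<open>m + h\<close> is handled by multiplying with \<open>q ^ (N - r)\<close>, which exchanges
  \<open>u\<close> and \<open>v\<close>.\<close>

lemma not_dvd_small_pair:
  fixes q m h n D u v t :: nat
  assumes q: "q \<ge> 2" and h: "0 < h" "h \<le> m" and m: "odd m"
    and n: "n = (q ^ (m + h) - 1) * (q ^ (m - h) + 1)"
    and nd: "n dvd q ^ (2 * (m + h)) - 1"
    and D: "D + 2 \<le> q ^ m + q ^ h" "h = m \<Longrightarrow> D + 3 \<le> 2 * q ^ m"
    and u: "0 < u" "u \<le> D" and v: "0 < v" "v \<le> D"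
    and t: "odd t"
  shows "\<not> n dvd u + v * q ^ t"
proof
  assume d: "n dvd u + v * q ^ t"
  define N where "N = 2 * (m + h)"
  define r where "r = t mod N"
  have r: "odd r" "r < N" using t h by (auto simp: r_def N_def mod_mod_cancel odd_iff_mod_2_eq_one)
  have one: "[q ^ (N * k) = 1] (mod n)" for k
    using cong_power_1[OF nd] q unfolding N_def by simp
  have "q ^ t = q ^ (N * (t div N)) * q ^ r" by (simp add: r_def flip: power_add)
  then have "[q ^ t = 1 * q ^ r] (mod n)" using one by (metis cong_scalar_right)
  then have "[u + v * q ^ t = u + v * q ^ r] (mod n)" by (intro cong_add cong_mult) auto
  then have dr: "n dvd u + v * q ^ r" using d cong_dvd_iff by blast
  show False
  proof (cases "r \<le> m + h")
    case True
    then show False using not_dvd_small_pair_aux[OF q h m n D u v r(1)] dr by blast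
  next
    case False
    have odd': "odd (N - r)" "N - r \<le> m + h" using r False by (auto simp: N_def)
    have "n dvd (u + v * q ^ r) * q ^ (N - r)" using dr by simp
    also have "(u + v * q ^ r) * q ^ (N - r) = u * q ^ (N - r) + v * q ^ (N * 1)"
      using r by (simp add: algebra_simps flip: power_add)
    finally have "n dvd u * q ^ (N - r) + v * q ^ (N * 1)" .
    moreover have "[u * q ^ (N - r) + v * q ^ (N * 1) = u * q ^ (N - r) + v * 1] (mod n)"
      by (intro cong_add cong_mult one cong_refl)
    ultimately have "n dvd v + u * q ^ (N - r)" using cong_dvd_iff by (metis add.commute mult_1_right)
    then show False using not_dvd_small_pair_aux[OF q h m n D v u odd'] by blast
  qed
qed

text \<open>Sharpness: \<open>w\<close> is one above the admissible bound, and its partner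
  \<open>u\<close> is no larger.\<close>

lemma exists_dvd_pair:
  fixes q m h n w :: nat
  assumes q: "q \<ge> 2" and h: "0 < h" "h \<le> m"
    and n: "n = (q ^ (m + h) - 1) * (q ^ (m - h) + 1)"
    and w: "w = (if h = m then 2 * q ^ m - 2 else q ^ m + q ^ h - 1)"
  shows "\<exists>u. 0 < u \<and> u \<le> w \<and> w < n \<and> n = u + w * q ^ m"
proof -
  note N = degree_bound_expand[OF h(2) q n]
  have pos: "q ^ i > 0" for i using q by simp
  have qm: "q ^ m \<ge> 2" using self_le_power[of q m] q h by simp
  \<comment> \<open>In both cases this is \<open>n - w * q ^ m\<close>; for \<open>h = m\<close> it
    equals \<open>w\<close> itself.\<close>
  define u where "u = (if h = m then 2 * q ^ m - 2 else q ^ m - q ^ (m - h) - 1)"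
  have "0 < u \<and> u \<le> w \<and> n = u + w * q ^ m"
  proof (cases "h = m")
    case True
    obtain k where k: "q ^ m = k + 2" using qm by (metis add.commute le_Suc_ex)
    have "n + 2 = 2 * (q ^ m * q ^ m)" using N True by (simp add: power_add)
    then show ?thesis using True by (simp add: u_def w k algebra_simps)
  next
    case False
    have a2: "q ^ (m - h) \<ge> 2" using self_le_power[of q "m - h"] q h False by simp
    have "q * q ^ (m - h) \<le> q ^ m"
      using power_increasing[of "Suc (m - h)" m q] h q by simp
    moreover have "2 * q ^ (m - h) \<le> q * q ^ (m - h)" using q by simp
    ultimately obtain k where k: "q ^ m = q ^ (m - h) + 2 + k"
      using a2 by (metis add_le_mono1 le_Suc_ex le_trans mult_2 add.commute)
    obtain l where l: "q ^ h = Suc l" using pos[of h] gr0_implies_Suc by blast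
    have "w = q ^ m + l" using False l by (simp add: w)
    moreover have "u = k + 1" using False k by (simp add: u_def)
    ultimately show ?thesis using N k by (simp add: power_add l algebra_simps)
  qed
  moreover have "w \<le> w * q ^ m" using q by simp
  ultimately show ?thesis by (intro exI[of _ u]) linarith
qed

section \<open>Cyclotomic cosets\<close>

lemma cyclotomic_cosetI: "(q ^ (2 * i) * e) mod n \<in> cyclotomic_coset q n e"
  by (auto simp: cyclotomic_coset_def)

lemma cyclotomic_coset_self: "e < n \<Longrightarrow> e \<in> cyclotomic_coset q n e"
  using cyclotomic_cosetI[of q 0 e n] by simp

lemma finite_cyclotomic_coset: "n > 0 \<Longrightarrow> finite (cyclotomic_coset q n e)"
  by (rule finite_subset[of _ "{..<n}"]) (auto simp: cyclotomic_coset_def)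

lemma cyclotomic_coset_subset:
  assumes "f \<in> cyclotomic_coset q n e"
  shows "cyclotomic_coset q n f \<subseteq> cyclotomic_coset q n e"
proof
  fix x assume "x \<in> cyclotomic_coset q n f"
  then obtain i where i: "x = q ^ (2 * i) * f mod n" by (auto simp: cyclotomic_coset_def)
  obtain j where "f = q ^ (2 * j) * e mod n" using assms by (auto simp: cyclotomic_coset_def)
  then have "x = q ^ (2 * (i + j)) * e mod n"
    unfolding i by (simp add: mod_mult_right_eq power_add algebra_simps)
  then show "x \<in> cyclotomic_coset q n e" by (simp only: cyclotomic_cosetI)
qed

text \<open>Since \<open>q ^ (2 * s)\<close> is 1 modulo \<open>n\<close>, multiplication by
  \<open>q ^ (2 * i)\<close> is undone by \<open>q ^ (2 * (s * i - i))\<close>, where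
  \<open>i \<le> s * i\<close>.\<close>

lemma cyclotomic_coset_sym:
  assumes "f \<in> cyclotomic_coset q n e" "e < n" "n dvd q ^ (2 * s) - 1" "q > 0" "s > 0"
  shows "e \<in> cyclotomic_coset q n f"
proof -
  obtain i where f: "f = q ^ (2 * i) * e mod n" using assms(1) by (auto simp: cyclotomic_coset_def)
  have "q ^ (2 * (s * i - i)) * f mod n = q ^ (2 * (s * i - i)) * q ^ (2 * i) * e mod n"
    unfolding f by (simp add: mod_mult_right_eq mult.assoc)
  also have "q ^ (2 * (s * i - i)) * q ^ (2 * i) = q ^ (2 * s * i)"
    using assms(5) by (simp add: diff_mult_distrib2 mult.assoc flip: power_add)
  also have "q ^ (2 * s * i) * e mod n = 1 * e mod n"
    using cong_power_1[OF assms(3,4), of i] by (metis cong_def cong_scalar_right)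
  finally show ?thesis using assms(2) by (metis cyclotomic_cosetI mod_less mult_1)
qed

text \<open>The minimum \<open>b j\<close> of the coset of \<open>w\<close> is at most
  \<open>b \<tau>\<close>, so strict monotonicity gives \<open>j \<le> \<tau>\<close>; and
  \<open>j \<noteq> 0\<close> because the coset of 0 contains only 0.\<close>

lemma cyclotomic_coset_subset_min:
  fixes b :: "nat \<Rightarrow> nat"
  assumes w: "0 < w" "w < n" and nd: "n dvd q ^ (2 * s) - 1" "q > 0" "s > 0"
    and b: "strict_mono_on {0..\<nu>} b" "b ` {0..\<nu>} = minimum_representatives q n" "b 0 = 0"
    and \<tau>: "w \<le> b \<tau>" "\<tau> \<le> \<nu>"
  shows "\<exists>j\<in>{1..\<tau>}. cyclotomic_coset q n w \<subseteq> cyclotomic_coset q n (b j)"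
proof -
  let ?C = "cyclotomic_coset q n w"
  have ne: "finite ?C" "w \<in> ?C" using finite_cyclotomic_coset cyclotomic_coset_self w by auto
  have "Min ?C \<in> minimum_representatives q n"
    using w by (auto simp: minimum_representatives_def cyclotomic_cosets_def)
  then have "Min ?C \<in> b ` {0..\<nu>}" using b(2) by simp
  then obtain j where j: "j \<le> \<nu>" "b j = Min ?C" by auto
  have mem: "b j \<in> ?C" unfolding j(2) using ne by (intro Min_in) auto
  have sym: "w \<in> cyclotomic_coset q n (b j)" using cyclotomic_coset_sym[OF mem w(2) nd] .
  have "b j \<le> b \<tau>" unfolding j(2) using Min_le[OF ne] \<tau>(1) by (rule order_trans)
  moreover have "b \<tau> < b j" if "\<tau> < j"
    using strict_mono_onD[OF b(1) _ _ that] j(1) \<tau>(2) by simp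
  ultimately have "j \<le> \<tau>" by (meson linorder_not_le)
  moreover have "j \<noteq> 0"
  proof
    assume "j = 0"
    with sym b(3) w show False by (auto simp: cyclotomic_coset_def)
  qed
  ultimately show ?thesis using cyclotomic_coset_subset[OF sym] by (intro bexI[of _ j]) auto
qed

section \<open>Finite fields\<close>

text \<open>Fermat's argument: multiplication by a nonzero \<open>x\<close> permutes
  \<open>K - {0}\<close>, so the product of these elements is unchanged by the factor
  \<open>x ^ (card K - 1)\<close>.\<close>

lemma power_card_subfield:
  fixes K :: "'a::{field,finite} set"
  assumes "subfield K (ring_of_type_algebra :: 'a ring)" "x \<in> K"
  shows "x ^ card K = x"
proof (cases "x = 0")
  case True
  then show ?thesis using assms by (metis card_gt_0_iff empty_iff finite power_0_left less_irrefl)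
next
  case False
  interpret ring "ring_of_type_algebra :: 'a ring" by (rule ring_from_type_algebra)
  have sr: "subring K (ring_of_type_algebra :: 'a ring)" using subfieldE(1)[OF assms(1)] .
  have zero: "0 \<in> K" using subringE(2)[OF sr] by (simp add: ring_of_type_algebra_def)
  have mult: "y * z \<in> K" if "y \<in> K" "z \<in> K" for y z
    using subringE(6)[OF sr that] by (simp add: ring_of_type_algebra_def)
  have bij: "bij_betw ((*) x) (K - {0}) (K - {0})"
    unfolding bij_betw_def
  proof
    show inj: "inj_on ((*) x) (K - {0})" using False by (auto intro: inj_onI)
    show "(*) x ` (K - {0}) = K - {0}"
      by (rule endo_inj_surj) (use inj False assms(2) mult in auto)
  qed
  have "x ^ (card K - 1) * \<Prod>(K - {0}) = (\<Prod>y\<in>K - {0}. x * y)"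
    using zero by (simp add: prod.distrib)
  also have "\<dots> = \<Prod>(K - {0})" using prod.reindex_bij_betw[OF bij, of "\<lambda>y. y"] .
  finally have "x ^ (card K - 1) = 1" by simp
  moreover have "card K > 0" using zero by (metis card_gt_0_iff empty_iff finite)
  ultimately show ?thesis by (metis mult_1 power_minus_mult)
qed

text \<open>The right-hand side contains \<open>K\<close> and, as the root set of a nonzero
  polynomial of degree at most \<open>card K\<close>, cannot be larger.\<close>

lemma subfield_eq_fixed_points:
  fixes K :: "'a::{field,finite} set"
  assumes "subfield K (ring_of_type_algebra :: 'a ring)" "card K \<ge> 2"
  shows "K = {x. x ^ card K = x}"
proof (rule card_seteq)
  let ?P = "Polynomial.monom (1::'a) (card K) - Polynomial.monom 1 1"
  have P: "?P \<noteq> 0" using assms(2) by (auto simp: poly_eq_iff intro!: exI[of _ "card K"])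
  have "{x::'a. x ^ card K = x} = {x. poly ?P x = 0}" by (auto simp: poly_monom)
  also have "card \<dots> \<le> Polynomial.degree ?P" using card_poly_roots_bound[OF P] .
  also have "\<dots> \<le> card K" using assms(2) by (intro degree_diff_le) (auto intro: order_trans[OF degree_monom_le])
  finally show "card {x::'a. x ^ card K = x} \<le> card K" .
qed (use power_card_subfield[OF assms(1)] in auto)

text \<open>Multiplication by a root \<open>x\<close> with \<open>x ^ e \<noteq> 1\<close> permutes
  the roots and scales the sum by \<open>x ^ e\<close>.\<close>

lemma sum_power_roots_of_unity_eq_0:
  fixes \<beta> :: "'n::finite \<Rightarrow> 'a::{field,finite}"
  assumes \<beta>: "bij_betw \<beta> UNIV {x. x ^ n = 1}" and n: "CARD('n) = n" and e: "\<not> n dvd e"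
  shows "(\<Sum>i\<in>UNIV. \<beta> i ^ e) = 0"
proof -
  have n0: "n > 0" using n by (metis zero_less_card_finite)
  \<comment> \<open>Otherwise the \<open>n\<close> roots would all be zeros of \<open>X ^ (e mod n) - 1\<close>.\<close>
  have "\<exists>x::'a. x ^ n = 1 \<and> x ^ e \<noteq> 1"
  proof (rule ccontr)
    assume "\<not> ?thesis"
    then have *: "x ^ e = 1" if "x ^ n = 1" for x :: 'a using that by blast
    define d where "d = e mod n"
    have d: "0 < d" "d < n" using e n0 by (auto simp: d_def mod_greater_zero_iff_not_dvd)
    let ?P = "Polynomial.monom (1::'a) d - 1"
    have "Polynomial.coeff ?P d = 1" using d by simp
    then have P: "?P \<noteq> 0" by (metis coeff_0 zero_neq_one)
    have "{x::'a. x ^ n = 1} \<subseteq> {x. poly ?P x = 0}"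
    proof
      fix x :: 'a assume "x \<in> {x. x ^ n = 1}"
      then have x: "x ^ n = 1" by simp
      have "x ^ e = (x ^ n) ^ (e div n) * x ^ d"
        by (simp add: d_def flip: power_mult power_add)
      then show "x \<in> {x. poly ?P x = 0}" using x * by (simp add: poly_monom)
    qed
    then have "card {x::'a. x ^ n = 1} \<le> card {x. poly ?P x = 0}" by (intro card_mono) auto
    also have "\<dots> \<le> Polynomial.degree ?P" using card_poly_roots_bound[OF P] .
    also have "\<dots> \<le> d" by (intro degree_diff_le) (auto intro: degree_monom_le)
    finally show False using bij_betw_same_card[OF \<beta>] n d by simp
  qed
  then obtain x :: 'a where x: "x ^ n = 1" "x ^ e \<noteq> 1" by blast
  have x0: "x \<noteq> 0" using x n0 by (auto simp: power_0_left)
  have bij: "bij_betw ((*) x) {z. z ^ n = 1} {z. z ^ n = 1}"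
    unfolding bij_betw_def
  proof
    show inj: "inj_on ((*) x) {z. z ^ n = 1}" using x0 by (auto intro: inj_onI)
    show "(*) x ` {z. z ^ n = 1} = {z. z ^ n = 1}"
      by (rule endo_inj_surj) (use inj x in \<open>auto simp: power_mult_distrib\<close>)
  qed
  have S: "(\<Sum>i\<in>UNIV. \<beta> i ^ e) = (\<Sum>z\<in>{z. z ^ n = 1}. z ^ e)"
    using sum.reindex_bij_betw[OF \<beta>, of "\<lambda>z. z ^ e"] .
  have "x ^ e * (\<Sum>z\<in>{z. z ^ n = 1}. z ^ e) = (\<Sum>z\<in>{z. z ^ n = 1}. (x * z) ^ e)"
    by (simp add: sum_distrib_left power_mult_distrib)
  also have "\<dots> = (\<Sum>z\<in>{z. z ^ n = 1}. z ^ e)"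
    using sum.reindex_bij_betw[OF bij, of "\<lambda>z. z ^ e"] .
  finally have "(x ^ e - 1) * (\<Sum>z\<in>{z. z ^ n = 1}. z ^ e) = 0" by (simp add: algebra_simps)
  then show ?thesis using x S by simp
qed

text \<open>As a polynomial in \<open>c\<close> the sum has linear coefficient \<open>f 0\<close>
  and degree at most \<open>Q ^ (s - 1)\<close>, too small to vanish on the whole field.\<close>

lemma linearized_poly_nonzero:
  fixes f :: "nat \<Rightarrow> 'a::{field,finite}"
  assumes Q: "Q \<ge> 2" and s: "s > 0" and card: "CARD('a) = Q ^ s" and f: "f 0 \<noteq> 0"
  shows "\<exists>c. (\<Sum>i<s. f i * c ^ (Q ^ i)) \<noteq> 0"
proof (rule ccontr)
  assume "\<not> ?thesis"
  then have z: "(\<Sum>i<s. f i * c ^ (Q ^ i)) = 0" for c by blast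
  define P where "P = (\<Sum>i<s. Polynomial.monom (f i) (Q ^ i))"
  have "Polynomial.coeff P 1 = (\<Sum>i<s. if i = 0 then f i else 0)"
    unfolding P_def coeff_sum using Q by (intro sum.cong) auto
  also have "\<dots> = f 0" using s by (simp add: sum.delta)
  finally have P: "P \<noteq> 0" using f by auto
  have "Q ^ s = card {x. poly P x = 0}"
    using z by (simp add: P_def poly_sum poly_monom card)
  also have "\<dots> \<le> Polynomial.degree P" using card_poly_roots_bound[OF P] .
  also have "\<dots> \<le> Q ^ (s - 1)" unfolding P_def
    using Q by (intro degree_sum_le) (auto intro!: order_trans[OF degree_monom_le] power_increasing)
  also have "\<dots> < Q ^ s" using Q s by (intro power_strict_increasing) auto
  finally show False by simp
qed

text \<open>Needed to make \<open>x ^ q\<close> additive in \<open>x\<close>.\<close>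

lemma primepow_eq_CHAR_power:
  assumes "primepow q" "CARD('a::{field,finite}) = q ^ k"
  shows "Factorial_Ring.prime CHAR('a) \<and> (\<exists>l. q = CHAR('a) ^ l)"
proof -
  have pr: "Factorial_Ring.prime CHAR('a)" by (intro prime_CHAR_semidom finite_imp_CHAR_pos) auto
  obtain p l where p: "Factorial_Ring.prime p" "q = p ^ l" using assms(1) by (auto simp: primepow_def)
  have "CHAR('a) dvd p ^ (l * k)" using CHAR_dvd_CARD[where ?'a = 'a] assms(2) p(2) by (simp add: power_mult)
  then have "CHAR('a) = p" using pr p(1) prime_dvd_power primes_dvd_imp_eq by blast
  then show ?thesis using pr p(2) by blast
qed

text \<open>On a field of order \<open>Q ^ s\<close> this is the trace onto the subfield of order
  \<open>Q\<close>.\<close>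

definition frobenius_trace :: "nat \<Rightarrow> nat \<Rightarrow> 'a::comm_semiring_1 \<Rightarrow> 'a" where
  "frobenius_trace Q s z = (\<Sum>i<s. z ^ (Q ^ i))"

lemma frobenius_trace_mult_fixed:
  assumes "k ^ Q = k"
  shows "frobenius_trace Q s (z * k) = frobenius_trace Q s z * k"
proof -
  have "k ^ (Q ^ i) = k" for i
    by (induction i) (simp_all add: power_mult assms)
  then show ?thesis by (simp add: frobenius_trace_def power_mult_distrib sum_distrib_right)
qed

section \<open>Trace words\<close>

locale unity_evaluation =
  fixes q s n :: nat and K :: "'a::{field,finite} set" and \<beta> :: "'n::finite \<Rightarrow> 'a"
  assumes primepow_q: "primepow q" and s_pos: "s > 0"
    and card_field: "CARD('a) = q ^ (2 * s)"
    and subfield_K: "subfield K (ring_of_type_algebra :: 'a ring)"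
    and card_K: "card K = q ^ 2"
    and n_dvd: "n dvd q ^ (2 * s) - 1"
    and n_eq: "CARD('n) = n"
    and roots: "bij_betw \<beta> UNIV {x. x ^ n = 1}"
begin

lemma q_ge_2: "q \<ge> 2" using primepow_gt_Suc_0[OF primepow_q] by simp

lemma card_field': "CARD('a) = (q ^ 2) ^ s" using card_field by (simp add: power_mult)

lemma square_ge_2: "q ^ 2 \<ge> 2"
  using self_le_power[of q 2] q_ge_2 by simp

lemma n_pos: "n > 0" using n_eq by (metis zero_less_card_finite)

lemma sum_power_q: "sum f A ^ (q ^ i) = (\<Sum>x\<in>A. f x ^ (q ^ i))" for f :: "'b \<Rightarrow> 'a"
proof -
  from primepow_eq_CHAR_power[OF primepow_q card_field] obtain l
    where "Factorial_Ring.prime CHAR('a)" "q = CHAR('a) ^ l" by blast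
  then show ?thesis by (intro freshmans_dream_sum'[where n = "l * i"]) (auto simp: power_mult)
qed

lemma sum_power_q': "sum f A ^ q = (\<Sum>x\<in>A. f x ^ q)" for f :: "'b \<Rightarrow> 'a"
  using sum_power_q[of f A 1] by simp

lemma sum_power_square: "sum f A ^ ((q ^ 2) ^ i) = (\<Sum>x\<in>A. f x ^ ((q ^ 2) ^ i))" for f :: "'b \<Rightarrow> 'a"
  using sum_power_q[of f A "2 * i"] by (simp add: power_mult)

lemma add_power_q: "(x + y) ^ q = x ^ q + y ^ q" for x y :: 'a
  using sum_power_q'[of "\<lambda>c. if c then x else y" UNIV] by (simp add: UNIV_bool add.commute)

lemma power_field_card: "x ^ ((q ^ 2) ^ s) = x" for x :: 'a
proof -
  have "subfield UNIV (ring_of_type_algebra :: 'a ring)"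
    using field.carrier_is_subfield[OF field_from_type_algebra] by (simp add: ring_of_type_algebra_def)
  from power_card_subfield[OF this, of x] show ?thesis by (simp add: card_field')
qed

text \<open>If \<open>n\<close> vanished in the field, \<open>q ^ (2 * s)\<close> would be 1 there;
  but it is the field order, which is 0.\<close>

lemma of_nat_n_nonzero: "of_nat n \<noteq> (0::'a)"
proof
  assume z: "of_nat n = (0::'a)"
  obtain k where "q ^ (2 * s) - 1 = n * k" using n_dvd by blast
  then have "q ^ (2 * s) = n * k + 1" using q_ge_2
    by (metis Suc_eq_plus1 Suc_pred' diff_Suc_1 less_le_trans pos2 zero_less_power One_nat_def)
  then have "of_nat CARD('a) = (1::'a)" using z by (simp add: card_field)
  then show False using CHAR_dvd_CARD[where ?'a = 'a] of_nat_eq_0_iff_char_dvd by (metis zero_neq_one)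
qed

lemma sum_roots: "(\<Sum>p\<in>UNIV. \<beta> p ^ e) = (if n dvd e then of_nat n else 0)"
proof (cases "n dvd e")
  case True
  have "\<beta> p ^ n = 1" for p using roots by (auto simp: bij_betw_def)
  then show ?thesis using True by (auto simp: power_mult n_eq)
next
  case False
  then show ?thesis using sum_power_roots_of_unity_eq_0[OF roots n_eq] by simp
qed

lemma root_power_mod: "\<beta> p ^ (e mod n) = \<beta> p ^ e"
proof -
  have "\<beta> p ^ n = 1" using roots by (auto simp: bij_betw_def)
  moreover have "\<beta> p ^ e = (\<beta> p ^ n) ^ (e div n) * \<beta> p ^ (e mod n)"
    by (simp flip: power_mult power_add)
  ultimately show ?thesis by simp
qed

lemma mem_K_iff: "x \<in> K \<longleftrightarrow> x ^ (q ^ 2) = x"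
  using subfield_eq_fixed_points[OF subfield_K] square_ge_2 by (auto simp: card_K)

lemma frobenius_trace_sum:
  "frobenius_trace (q ^ 2) s (sum f A) = (\<Sum>x\<in>A. frobenius_trace (q ^ 2) s (f x))" for f :: "'b \<Rightarrow> 'a"
  unfolding frobenius_trace_def sum_power_square by (rule sum.swap)

text \<open>Raising to the power \<open>q ^ 2\<close> shifts the summands cyclically, the last
  returning to \<open>z\<close>.\<close>

lemma frobenius_trace_in_K: "frobenius_trace (q ^ 2) s z \<in> K"
proof -
  let ?f = "\<lambda>i. z ^ ((q ^ 2) ^ i)"
  have "frobenius_trace (q ^ 2) s z ^ (q ^ 2) = (\<Sum>i<s. ?f (Suc i))"
    unfolding frobenius_trace_def using sum_power_q[of ?f "{..<s}" 2]
    by (simp add: mult.commute flip: power_mult)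
  moreover have "?f 0 + (\<Sum>i<s. ?f (Suc i)) = (\<Sum>i<s. ?f i) + ?f s"
    using sum.lessThan_Suc_shift[of ?f s] by simp
  ultimately show ?thesis unfolding mem_K_iff
    using power_field_card[of z] by (simp add: frobenius_trace_def)
qed

text \<open>In the variable \<open>c\<close> the trace is a linearized polynomial with linear
  coefficient \<open>x\<close>.\<close>

lemma frobenius_trace_nondegenerate:
  assumes "\<And>c. frobenius_trace (q ^ 2) s (c * x) = 0"
  shows "x = (0::'a)"
proof (rule ccontr)
  assume "x \<noteq> 0"
  then obtain c where "(\<Sum>i<s. x ^ ((q ^ 2) ^ i) * c ^ ((q ^ 2) ^ i)) \<noteq> 0"
    using linearized_poly_nonzero[OF square_ge_2 s_pos card_field', of "\<lambda>i. x ^ ((q ^ 2) ^ i)"] by auto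
  then show False using assms[of c] by (simp add: frobenius_trace_def power_mult_distrib mult.commute)
qed

text \<open>Coordinatewise traces of monomial words supply test words with entries in
  \<open>K\<close>.\<close>

definition trace_word :: "'a \<Rightarrow> nat \<Rightarrow> 'a ^ 'n" where
  "trace_word c w = (\<chi> p. frobenius_trace (q ^ 2) s (c * \<beta> p ^ w))"

text \<open>Expanding the trace produces only exponents from the coset of \<open>e\<close>. The
  factor \<open>q ^ (2 * k)\<close> moves within that coset.\<close>

lemma trace_word_in_BCH_code:
  assumes "j \<in> {1..\<tau>}" "cyclotomic_coset q n e \<subseteq> cyclotomic_coset q n (b j)"
  shows "trace_word c (e * q ^ (2 * k)) \<in> BCH_code q n K \<beta> b \<tau>"
proof -
  let ?\<Delta> = "\<Union>j\<in>{1..\<tau>}. cyclotomic_coset q n (b j)"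
  have eq: "trace_word c (e * q ^ (2 * k)) =
      (\<Sum>i<s. c ^ ((q ^ 2) ^ i) *s (\<chi> p. \<beta> p ^ ((q ^ (2 * (i + k)) * e) mod n)))"
  proof -
    have "(c * \<beta> p ^ (e * q ^ (2 * k))) ^ ((q ^ 2) ^ i) =
        c ^ ((q ^ 2) ^ i) * \<beta> p ^ (q ^ (2 * (i + k)) * e)" for p i
    proof -
      have "e * q ^ (2 * k) * (q ^ 2) ^ i = q ^ (2 * (i + k)) * e"
        by (simp add: distrib_left power_add power_mult)
      then show ?thesis by (simp only: power_mult_distrib flip: power_mult)
    qed
    then show ?thesis
      by (simp add: vec_eq_iff trace_word_def frobenius_trace_def root_power_mod)
  qed
  have "(\<chi> p. \<beta> p ^ ((q ^ (2 * (i + k)) * e) mod n)) \<in> evaluation_code \<beta> ?\<Delta>" for i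
    unfolding evaluation_code_def
    using assms cyclotomic_cosetI[of q "i + k" e n] by (intro vec.span_base) blast
  then have "trace_word c (e * q ^ (2 * k)) \<in> evaluation_code \<beta> ?\<Delta>"
    unfolding eq evaluation_code_def by (intro vec.span_sum vec.span_scale)
  then show ?thesis by (simp add: BCH_code_def trace_word_def frobenius_trace_in_K)
qed

text \<open>If all these products vanished, nondegeneracy would strip off the outer trace, leaving a
  polynomial identity in \<open>d\<close> that the character sum at \<open>u + v * q\<close>
  contradicts.\<close>

lemma trace_words_not_orthogonal:
  assumes "n dvd u + v * q"
  shows "\<exists>c d. (\<Sum>p\<in>UNIV. trace_word c u $ p * (trace_word d v $ p) ^ q) \<noteq> 0"
proof (rule ccontr)
  assume "\<not> ?thesis"
  then have orth: "(\<Sum>p\<in>UNIV. trace_word c u $ p * (trace_word d v $ p) ^ q) = 0" for c d by blast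
  have zero: "(\<Sum>p\<in>UNIV. \<beta> p ^ u * (trace_word d v $ p) ^ q) = 0" for d
  proof (rule frobenius_trace_nondegenerate)
    fix c
    \<comment> \<open>Entries in \<open>K\<close> stay in \<open>K\<close> under the power
      \<open>q\<close>, so the second factor can be moved inside the trace.\<close>
    have fixed: "((trace_word d v $ p) ^ q) ^ (q ^ 2) = (trace_word d v $ p) ^ q" for p
    proof -
      have "(trace_word d v $ p) ^ (q ^ 2) = trace_word d v $ p"
        using frobenius_trace_in_K[of "d * \<beta> p ^ v"] by (simp add: mem_K_iff trace_word_def)
      moreover have "((trace_word d v $ p) ^ q) ^ (q ^ 2) = ((trace_word d v $ p) ^ (q ^ 2)) ^ q"
        unfolding power_mult[symmetric] by (simp only: mult.commute)
      ultimately show ?thesis by simp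
    qed
    have "frobenius_trace (q ^ 2) s (c * (\<Sum>p\<in>UNIV. \<beta> p ^ u * (trace_word d v $ p) ^ q)) =
        (\<Sum>p\<in>UNIV. frobenius_trace (q ^ 2) s (c * \<beta> p ^ u * (trace_word d v $ p) ^ q))"
      by (simp add: sum_distrib_left frobenius_trace_sum mult.assoc)
    also have "\<dots> = (\<Sum>p\<in>UNIV. trace_word c u $ p * (trace_word d v $ p) ^ q)"
      using frobenius_trace_mult_fixed[OF fixed] by (simp add: trace_word_def)
    finally show "frobenius_trace (q ^ 2) s (c * (\<Sum>p\<in>UNIV. \<beta> p ^ u * (trace_word d v $ p) ^ q)) = 0"
      using orth by simp
  qed
  \<comment> \<open>Expanding the trace turns \<open>zero\<close> into the vanishing of a linearized polynomial in \<open>d ^ q\<close>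
    whose linear coefficient is \<open>n\<close>.\<close>
  define f where "f i = (\<Sum>p\<in>UNIV. \<beta> p ^ (u + v * q * (q ^ 2) ^ i))" for i
  have "f 0 \<noteq> 0" unfolding f_def sum_roots using assms of_nat_n_nonzero by simp
  then obtain x where x: "(\<Sum>i<s. f i * x ^ ((q ^ 2) ^ i)) \<noteq> 0"
    using linearized_poly_nonzero[OF square_ge_2 s_pos card_field'] by blast
  \<comment> \<open>The \<open>q\<close>-th root of \<open>x\<close>, since
    \<open>x ^ (q ^ (2 * s)) = x\<close>.\<close>
  define d where "d = x ^ (q ^ (2 * s - 1))"
  have "q ^ (2 * s - 1) * q = (q ^ 2) ^ s"
    using s_pos power_minus_mult[of "2 * s" q] by (simp add: power_mult)
  then have d: "d ^ q = x" unfolding d_def using power_field_card[of x] by (simp flip: power_mult)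
  have "(\<Sum>p\<in>UNIV. \<beta> p ^ u * (trace_word d v $ p) ^ q) =
      (\<Sum>p\<in>UNIV. \<Sum>i<s. \<beta> p ^ (u + v * q * (q ^ 2) ^ i) * x ^ ((q ^ 2) ^ i))"
  proof (rule sum.cong[OF refl])
    fix p
    have "((d * \<beta> p ^ v) ^ ((q ^ 2) ^ i)) ^ q = \<beta> p ^ (v * q * (q ^ 2) ^ i) * x ^ ((q ^ 2) ^ i)" for i
    proof -
      have "((d * \<beta> p ^ v) ^ ((q ^ 2) ^ i)) ^ q = ((d * \<beta> p ^ v) ^ q) ^ ((q ^ 2) ^ i)"
        unfolding power_mult[symmetric] by (simp only: mult.commute)
      also have "\<dots> = (x * \<beta> p ^ (v * q)) ^ ((q ^ 2) ^ i)"
        unfolding power_mult_distrib d power_mult ..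
      also have "\<dots> = x ^ ((q ^ 2) ^ i) * \<beta> p ^ (v * q * (q ^ 2) ^ i)"
        by (simp only: power_mult_distrib power_mult)
      also have "\<dots> = \<beta> p ^ (v * q * (q ^ 2) ^ i) * x ^ ((q ^ 2) ^ i)" by (rule mult.commute)
      finally show ?thesis .
    qed
    then show "\<beta> p ^ u * (trace_word d v $ p) ^ q =
        (\<Sum>i<s. \<beta> p ^ (u + v * q * (q ^ 2) ^ i) * x ^ ((q ^ 2) ^ i))"
      by (simp add: trace_word_def frobenius_trace_def sum_power_q' sum_distrib_left power_add mult.assoc)
  qed
  also have "\<dots> = (\<Sum>i<s. f i * x ^ ((q ^ 2) ^ i))"
    unfolding f_def sum_distrib_right by (rule sum.swap)
  finally show False using x zero by simp
qed

text \<open>The form is linear in \<open>x\<close> and semilinear in \<open>y\<close>, so spanning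
  words suffice; there it is the character sum at \<open>e + f * q\<close>.\<close>

lemma evaluation_code_orthogonal:
  fixes x y :: "'a ^ 'n"
  assumes \<Delta>: "\<And>e f. e \<in> \<Delta> \<Longrightarrow> f \<in> \<Delta> \<Longrightarrow> \<not> n dvd e + f * q"
    and x: "x \<in> evaluation_code \<beta> \<Delta>" and y: "y \<in> evaluation_code \<beta> \<Delta>"
  shows "(\<Sum>p\<in>UNIV. x $ p * (y $ p) ^ q) = 0"
  using x unfolding evaluation_code_def
proof (induction rule: vec.span_induct)
  case base
  show ?case
    by (auto simp: vec.subspace_def distrib_right sum.distrib mult.assoc simp flip: sum_distrib_left)
next
  case (step x)
  then obtain e where e: "e \<in> \<Delta>" "x = (\<chi> p. \<beta> p ^ e)" by blast
  have "(\<Sum>p\<in>UNIV. \<beta> p ^ e * (y $ p) ^ q) = 0"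
    using y unfolding evaluation_code_def
  proof (induction rule: vec.span_induct)
    case base
    have "q > 0" using q_ge_2 by simp
    then show ?case
      by (auto simp: vec.subspace_def zero_power add_power_q distrib_left sum.distrib power_mult_distrib
          mult.left_commute simp flip: sum_distrib_left)
  next
    case (step y)
    then obtain f where f: "f \<in> \<Delta>" "y = (\<chi> p. \<beta> p ^ f)" by blast
    have "(\<Sum>p\<in>UNIV. \<beta> p ^ e * (y $ p) ^ q) = (\<Sum>p\<in>UNIV. \<beta> p ^ (e + f * q))"
      by (simp add: f power_add power_mult)
    then show ?case using sum_roots \<Delta>[OF e(1) f(1)] by simp
  qed
  then show ?case by (simp add: e)
qed

text \<open>Multiplying by a suitable even power of \<open>q\<close> turns \<open>e\<close> back
  into \<open>b j\<close>, and the exponent of \<open>q\<close> next to \<open>b l\<close> stays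
  odd.\<close>

lemma BCH_code_self_orthogonal:
  assumes "\<And>j l t. j \<in> {1..\<tau>} \<Longrightarrow> l \<in> {1..\<tau>} \<Longrightarrow> odd t \<Longrightarrow> \<not> n dvd b j + b l * q ^ t"
  shows "hermitian_self_orthogonal q (BCH_code q n K \<beta> b \<tau>)"
proof -
  let ?\<Delta> = "\<Union>j\<in>{1..\<tau>}. cyclotomic_coset q n (b j)"
  have "\<not> n dvd e + f * q" if ef: "e \<in> ?\<Delta>" "f \<in> ?\<Delta>" for e f
  proof
    assume d: "n dvd e + f * q"
    obtain j i where e: "j \<in> {1..\<tau>}" "e = q ^ (2 * i) * b j mod n"
      using ef by (auto simp: cyclotomic_coset_def)
    obtain l k where f: "l \<in> {1..\<tau>}" "f = q ^ (2 * k) * b l mod n"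
      using ef by (auto simp: cyclotomic_coset_def)
    define r where "r = 2 * (s * i - i)"
    have "[e * q ^ r + f * q * q ^ r =
        q ^ (2 * i) * b j * q ^ r + q ^ (2 * k) * b l * q * q ^ r] (mod n)"
      by (intro cong_add cong_mult cong_refl) (simp_all add: e f)
    also have "q ^ (2 * i) * b j * q ^ r = b j * q ^ (2 * s * i)"
      using s_pos by (simp add: r_def diff_mult_distrib2 mult.assoc mult.left_commute flip: power_add)
    also have "q ^ (2 * k) * b l * q * q ^ r = b l * q ^ (2 * k + 1 + r)"
      by (simp add: power_add)
    also have "[b j * q ^ (2 * s * i) + b l * q ^ (2 * k + 1 + r) =
        b j * 1 + b l * q ^ (2 * k + 1 + r)] (mod n)"
      using cong_power_1[OF n_dvd, of i] q_ge_2 by (intro cong_add cong_mult cong_refl) auto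
    finally have "[(e + f * q) * q ^ r = b j + b l * q ^ (2 * k + 1 + r)] (mod n)"
      by (simp add: distrib_right)
    then have "n dvd b j + b l * q ^ (2 * k + 1 + r)"
      using d cong_dvd_iff dvd_mult2 by blast
    moreover have "odd (2 * k + 1 + r)" by (simp add: r_def)
    ultimately show False using assms e(1) f(1) by blast
  qed
  from evaluation_code_orthogonal[OF this, of ?\<Delta>] show ?thesis
    unfolding hermitian_self_orthogonal_def BCH_code_def by blast
qed

text \<open>Of the odd power \<open>q ^ m\<close>, one factor \<open>q\<close> comes from the
  Hermitian conjugation; the remaining even power goes into the second trace word.\<close>

lemma BCH_code_not_self_orthogonal:
  assumes u: "0 < u" "u < n" "u \<le> b \<tau>" and w: "0 < w" "w < n" "w \<le> b \<tau>"
    and dvd: "n dvd u + w * q ^ m" "odd m"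
    and b: "strict_mono_on {0..\<nu>} b" "b ` {0..\<nu>} = minimum_representatives q n" "b 0 = 0" "\<tau> \<le> \<nu>"
  shows "\<not> hermitian_self_orthogonal q (BCH_code q n K \<beta> b \<tau>)"
proof -
  obtain k where k: "m = 2 * k + 1" using dvd(2) by (elim oddE)
  have q0: "q > 0" using q_ge_2 by simp
  note min = cyclotomic_coset_subset_min[OF _ _ n_dvd q0 s_pos b(1-3) _ b(4)]
  have "n dvd u * q ^ (2 * 0) + (w * q ^ (2 * k)) * q" using dvd(1) by (simp add: k ac_simps)
  from trace_words_not_orthogonal[OF this] obtain c d
    where "(\<Sum>p\<in>UNIV. trace_word c (u * q ^ (2 * 0)) $ p * (trace_word d (w * q ^ (2 * k)) $ p) ^ q) \<noteq> 0"
    by blast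
  moreover have "trace_word c (u * q ^ (2 * 0)) \<in> BCH_code q n K \<beta> b \<tau>"
    using min[OF u] trace_word_in_BCH_code by blast
  moreover have "trace_word d (w * q ^ (2 * k)) \<in> BCH_code q n K \<beta> b \<tau>"
    using min[OF w] trace_word_in_BCH_code by blast
  ultimately show ?thesis unfolding hermitian_self_orthogonal_def by blast
qed

end

section \<open>The sharp bound on \<open>b \<tau>\<close>\<close>

theorem proposition3p3:
  fixes q s a n1 \<nu> \<tau> :: nat
    and K :: "'a::{field,finite} set"
    and \<beta> :: "'n::finite \<Rightarrow> 'a"
    and b :: "nat \<Rightarrow> nat"
  assumes "primepow q"
    and "s \<ge> 2"
    and "a < s"
    and "even (s + a)"
    and "odd ((s + a) div 2)"
    and "n1 = (q ^ s - 1) * (q ^ a + 1)"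
    and "n1 dvd q ^ (2 * s) - 1"
    and "CARD('a) = q ^ (2 * s)"
    and "subfield K (ring_of_type_algebra :: 'a ring)"
    and "card K = q ^ 2"
    and "CARD('n) = n1"
    and "bij_betw \<beta> UNIV {x. x ^ n1 - 1 = 0}"
    and "strict_mono_on {0..\<nu>} b"
    and "b ` {0..\<nu>} = minimum_representatives q n1"
    and "b 0 = 0"
    and "1 \<le> \<tau>"
    and "\<tau> \<le> \<nu>"
  shows
    "(a \<noteq> 0 \<longrightarrow>
        (hermitian_self_orthogonal q (BCH_code q n1 K \<beta> b \<tau>) \<longleftrightarrow>
          int (b \<tau>) \<le> int q ^ ((s + a) div 2) + int q ^ ((s - a) div 2) - 2)) \<and>
     (a = 0 \<longrightarrow>
        (hermitian_self_orthogonal q (BCH_code q n1 K \<beta> b \<tau>) \<longleftrightarrow>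
          int (b \<tau>) \<le> 2 * int q ^ (s div 2) - 3))"
proof -
  define m h where "m = (s + a) div 2" and "h = (s - a) div 2"
  obtain k where "s + a = 2 * k" using assms(4) by blast
  then have "m = k" "h = k - a" "s - a = 2 * (k - a)" "a < k" using assms(3) by (auto simp: m_def h_def)
  then have s: "s = m + h" and a: "a = m - h" and h: "0 < h" "h \<le> m"
    using assms(3) by linarith+
  have m: "odd m" using assms(5) by (simp add: m_def)
  have n: "n1 = (q ^ (m + h) - 1) * (q ^ (m - h) + 1)" using assms(6) by (simp flip: s a)
  interpret unity_evaluation q s n1 K \<beta>
    using assms(1,2,7-12) by (intro unity_evaluation.intro) simp_all
  \<comment> \<open>The first excluded value, one above the stated bound; \<open>h = m\<close> means
    \<open>a = 0\<close>.\<close>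
  define w where "w = (if h = m then 2 * q ^ m - 2 else q ^ m + q ^ h - 1)"
  have main: "hermitian_self_orthogonal q (BCH_code q n1 K \<beta> b \<tau>) \<longleftrightarrow> b \<tau> < w"
  proof
    assume lt: "b \<tau> < w"
    have D: "b \<tau> + 2 \<le> q ^ m + q ^ h" "h = m \<Longrightarrow> b \<tau> + 3 \<le> 2 * q ^ m"
      using lt by (auto simp: w_def split: if_splits)
    have range: "0 < b j \<and> b j \<le> b \<tau>" if "j \<in> {1..\<tau>}" for j
      using that assms(15,17) strict_mono_onD[OF assms(13), of 0 j]
        strict_mono_onD[OF assms(13), of j \<tau>] by (cases "j = \<tau>") auto
    show "hermitian_self_orthogonal q (BCH_code q n1 K \<beta> b \<tau>)"
    proof (rule BCH_code_self_orthogonal)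
      fix j l t assume "j \<in> {1..\<tau>}" "l \<in> {1..\<tau>}" "odd (t::nat)"
      then show "\<not> n1 dvd b j + b l * q ^ t"
        using range n_dvd by (intro not_dvd_small_pair[OF q_ge_2 h m n _ D]) (auto simp: s)
    qed
  next
    assume so: "hermitian_self_orthogonal q (BCH_code q n1 K \<beta> b \<tau>)"
    obtain u where u: "0 < u" "u \<le> w" "w < n1" "n1 = u + w * q ^ m"
      using exists_dvd_pair[OF q_ge_2 h n w_def] by blast
    show "b \<tau> < w"
    proof (rule ccontr)
      assume "\<not> b \<tau> < w"
      then have "w \<le> b \<tau>" "u \<le> b \<tau>" "u < n1" "0 < w"
        using u by linarith+
      moreover have "n1 dvd u + w * q ^ m" using u(4) by simp
      ultimately show False
        using BCH_code_not_self_orthogonal[OF u(1) _ _ _ u(3) _ _ m assms(13-15,17)] so by blast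
    qed
  qed
  have "q ^ m \<ge> 2" using self_le_power[of q m] q_ge_2 h by simp
  \<comment> \<open>By \<open>q ^ m \<ge> 2\<close> the subtractions in \<open>w\<close> are not
    truncated, so \<open>b \<tau> < w\<close> agrees with the integer bounds.\<close>
  then have "int w = (if a = 0 then 2 * int q ^ m - 2 else int q ^ m + int q ^ h - 1)"
    using h by (auto simp: w_def a of_nat_diff)
  moreover have "s div 2 = m" if "a = 0" using that h s a by simp
  ultimately show ?thesis
    unfolding main m_def[symmetric] h_def[symmetric] by auto
qed

end
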